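(* For any $\epsilon>0$, no (deterministic online) algorithm can be $(1.5-\epsilon)$-competitive for closed online TSP on the line under the LOCATIONS prediction model, even when the predictions are perfect (prediction error $\eta=0$), against an adaptive adversary that chooses release times after observing the algorithm's moves.
   Context: Online TSP on the line: an agent starts at the origin at time $0$ and moves on the real line with speed at most $1$. There is a set $Q=\{q_1,\dots,q_n\}$ of requests, each with a position (also denoted $q_i$) and a release time; the algorithm knows $n$ in advance. A request $q$ is served at time $t$ if the agent was at position $q$ at some time $t'$ with $rel(q)\le t'\le t$. In the closed variant the makespan $|ALG|$ is the first time at which all requests are served and the agent is back at the origin; $|OPT|$ is the optimal offline makespan; $c$-competitive means $|ALG|\le c|OPT|$ on every instance. LOCATIONS prediction model: at time $0$ the algorithm receives predicted positions $p_1,\dots,p_n$ for $q_1,\dots,q_n$; the error is $\eta=\max_i|q_i-p_i|/(|L|+|R|)$, with $L=\min Q$, $R=\max Q$ (a request at the origin released at time $0$ is assumed present). *)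

theory Defs
  imports "HOL-Analysis.Analysis"
begin

text \<open>A request is a pair of its position and its release time. Instances and predictions are
  lists of equal length; the \<open>i\<close>-th prediction is for the \<open>i\<close>-th request.\<close>

type_synonym request = "real \<times> real"

abbreviation location :: "request \<Rightarrow> real" where "location \<equiv> fst"

abbreviation release :: "request \<Rightarrow> real" where "release \<equiv> snd"

definition tsp_instance :: "request list \<Rightarrow> bool" where
  "tsp_instance Q \<longleftrightarrow> (0, 0) \<in> set Q \<and> (\<forall>q\<in>set Q. 0 \<le> release q)"

definition agent_path :: "(real \<Rightarrow> real) \<Rightarrow> bool" where
  "agent_path x \<longleftrightarrow> x 0 = 0 \<and> 1-lipschitz_on {0..} x"

definition served :: "(real \<Rightarrow> real) \<Rightarrow> request \<Rightarrow> real \<Rightarrow> bool" where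
  "served x q t \<longleftrightarrow> (\<exists>t'. release q \<le> t' \<and> t' \<le> t \<and> x t' = location q)"

text \<open>For an agent path the infimum is attained whenever the set is nonempty (the set is closed);
  the makespan is \<open>\<infinity>\<close> if the tour is never completed.\<close>

definition makespan :: "(real \<Rightarrow> real) \<Rightarrow> request list \<Rightarrow> ereal" where
  "makespan x Q = (INF t\<in>{t. 0 \<le> t \<and> (\<forall>q\<in>set Q. served x q t) \<and> x t = 0}. ereal t)"

definition opt :: "request list \<Rightarrow> ereal" where
  "opt Q = (INF x\<in>{x. agent_path x}. makespan x Q)"

text \<open>The quotient is taken in \<^typ>\<open>ereal\<close>, where \<open>0 / 0 = 0\<close> and \<open>a / 0 = \<infinity>\<close> for \<open>a > 0\<close>.
  So the error is \<open>0\<close> exactly for perfect predictions, also if all requests are at the origin.\<close>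

definition prediction_error :: "request list \<Rightarrow> real list \<Rightarrow> ereal" where
  "prediction_error Q p =
     (let L = Min (location ` set Q); R = Max (location ` set Q)
      in ereal (MAX i\<in>{..<length Q}. \<bar>location (Q ! i) - p ! i\<bar>) / ereal (\<bar>L\<bar> + \<bar>R\<bar>))"

text \<open>The online information at time \<open>t\<close>: the released requests, with their indices and release
  times. The length of the list gives the number of requests in advance.\<close>

definition revealed :: "request list \<Rightarrow> real \<Rightarrow> request option list" where
  "revealed Q t = map (\<lambda>q. if release q \<le> t then Some q else None) Q"

text \<open>A deterministic online algorithm computes the position of the agent from the predictions,
  the information revealed so far and the current time. As release times are part of the
  revealed information, it determines the whole history up to that time.\<close>

type_synonym strategy = "real list \<Rightarrow> request option list \<Rightarrow> real \<Rightarrow> real"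

definition trajectory :: "strategy \<Rightarrow> real list \<Rightarrow> request list \<Rightarrow> real \<Rightarrow> real" where
  "trajectory A p Q t = A p (revealed Q t) t"

definition online_algorithm :: "strategy \<Rightarrow> bool" where
  "online_algorithm A \<longleftrightarrow>
     (\<forall>Q p. tsp_instance Q \<and> length p = length Q \<longrightarrow> agent_path (trajectory A p Q))"

text \<open>Competitiveness for predictions of error at most \<open>\<eta>\<close>: \<open>\<eta> = 0\<close> restricts to perfect
  predictions, \<open>\<eta> = \<infinity>\<close> imposes no restriction.\<close>

definition competitive_within :: "ereal \<Rightarrow> real \<Rightarrow> strategy \<Rightarrow> bool" where
  "competitive_within \<eta> c A \<longleftrightarrow>
     (\<forall>Q p. tsp_instance Q \<and> length p = length Q \<and> prediction_error Q p \<le> \<eta> \<longrightarrow>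
        makespan (trajectory A p Q) Q \<le> ereal c * opt Q)"

text \<open>An adaptive adversary for \<open>n\<close> requests maps the movement of the agent to release times.
  Which requests are released up to time \<open>t\<close>, and when, depends only on the movement up to
  time \<open>t\<close>.\<close>

definition adaptive_adversary :: "nat \<Rightarrow> ((real \<Rightarrow> real) \<Rightarrow> real list) \<Rightarrow> bool" where
  "adaptive_adversary n adv \<longleftrightarrow>
     (\<forall>x. agent_path x \<longrightarrow> length (adv x) = n) \<and>
     (\<forall>x y t. agent_path x \<and> agent_path y \<and> (\<forall>s\<in>{0..t}. x s = y s) \<longrightarrow>
        (\<forall>i<n. adv x ! i \<le> t \<longrightarrow> adv y ! i = adv x ! i))"

end

theory Submission
  imports Defs
begin

text \<open>Requests lie on a fine grid of \<open>[-1, 1]\<close>. The adversary lets the request at \<open>y\<close> appear at time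
  \<open>2 - \<bar>y\<bar>\<close>, on both sides, until the agent meets this shrinking front, say at \<open>c = 2 - s\<close> on the
  right at time \<open>s\<close>. The remaining requests on the right are then postponed to \<open>4 - y\<close>. The optimum
  sweeps \<open>0, -1, 1, 0\<close> in time \<open>4\<close>. The agent has served neither extreme point before time \<open>s\<close>.
  If it serves the grid point just below \<open>c\<close> before \<open>-1\<close>, or \<open>-1\<close> before \<open>1\<close>, then it
  returns at time \<open>6\<close> at the earliest; in the order \<open>1\<close>, \<open>-1\<close>, grid point, it loses at most two
  mesh widths compared to that.\<close>

section \<open>The front and the adversary's release times\<close>

definition front_hit :: "(real \<Rightarrow> real) \<Rightarrow> real \<Rightarrow> bool" where
  "front_hit x s \<longleftrightarrow> 1 \<le> s \<and> \<bar>x s\<bar> = 2 - s \<and> (\<forall>r\<in>{1..<s}. \<bar>x r\<bar> < 2 - r)"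

definition postponed :: "(real \<Rightarrow> real) \<Rightarrow> real \<Rightarrow> bool" where
  "postponed x y \<longleftrightarrow> (\<exists>s. front_hit x s \<and> s < 2 - \<bar>y\<bar> \<and> 0 < x s * y)"

text \<open>At \<open>4 - \<bar>y\<bar>\<close> a full-speed tour that visits the other side first
  passes \<open>y\<close> on its way home, so postponing costs the optimum nothing.\<close>

definition release_time :: "(real \<Rightarrow> real) \<Rightarrow> real \<Rightarrow> real" where
  "release_time x y = (if y = 0 then 0 else if postponed x y then 4 - \<bar>y\<bar> else 2 - \<bar>y\<bar>)"

definition grid :: "nat \<Rightarrow> real list" where
  "grid N = map (\<lambda>k. real_of_int k / real N) [- int N..int N]"

lemma agent_path_dist:
  assumes "agent_path x" "0 \<le> s" "0 \<le> t"
  shows "\<bar>x s - x t\<bar> \<le> \<bar>s - t\<bar>"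
  using assms lipschitz_onD[of 1 "{0..}" x s t] by (auto simp: agent_path_def dist_real_def)

lemma agent_path_abs_le:
  assumes "agent_path x" "0 \<le> t"
  shows "\<bar>x t\<bar> \<le> t"
  using agent_path_dist[OF assms(1), of t 0] assms by (simp add: agent_path_def)

lemma front_hit_le: "front_hit x s \<Longrightarrow> s \<le> 2"
  unfolding front_hit_def by linarith

lemma front_hit_not_less:
  assumes "front_hit x s" "front_hit x t"
  shows "\<not> s < t"
proof
  assume "s < t"
  then have "s \<in> {1..<t}"
    using assms(1) by (simp add: front_hit_def)
  then have "\<bar>x s\<bar> < 2 - s"
    using assms(2) unfolding front_hit_def by blast
  then show False
    using assms(1) by (simp add: front_hit_def)
qed

lemma front_hit_unique: "front_hit x s \<Longrightarrow> front_hit x t \<Longrightarrow> s = t"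
  by (meson front_hit_not_less linorder_cases)

lemma front_hit_cong:
  assumes "\<And>r. r \<in> {0..s} \<Longrightarrow> x r = y r"
  shows "front_hit x s \<longleftrightarrow> front_hit y s"
proof (cases "1 \<le> s")
  case True
  have "\<forall>r\<in>{1..<s}. x r = y r" "x s = y s"
    using assms True by auto
  then show ?thesis
    by (simp add: front_hit_def)
qed (simp add: front_hit_def)

text \<open>By the speed limit, \<open>\<bar>x t\<bar> + t\<close> is at most 2 at time 1, and it is
  at least 2 at time 2. By continuity there is a least time in between at which it equals 2.\<close>

lemma front_hit_exists:
  assumes x: "agent_path x"
  obtains s where "front_hit x s"
proof -
  have cont: "continuous_on {0..} x"
    using x lipschitz_on_continuous_on by (auto simp: agent_path_def)
  have cont': "continuous_on {a..b} (\<lambda>t. \<bar>x t\<bar> + t)" if "0 \<le> a" for a b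
    using that by (intro continuous_intros continuous_on_subset[OF cont]) auto
  have one: "\<bar>x 1\<bar> + 1 \<le> 2"
    using agent_path_abs_le[OF x, of 1] by simp
  define S where "S = {t\<in>{1..2}. \<bar>x t\<bar> + t = 2}"
  \<comment> \<open>Used at \<open>t = 2\<close> for existence, and at a supposed earlier time on or
    beyond the front for minimality.\<close>
  have crossing: "\<exists>r. 1 \<le> r \<and> r \<le> t \<and> \<bar>x r\<bar> + r = 2" if "1 \<le> t" "2 \<le> \<bar>x t\<bar> + t" for t
    using IVT'[of "\<lambda>t. \<bar>x t\<bar> + t" 1 2 t] that one cont'[of 1 t] by auto
  have "S = {1..2} \<inter> (\<lambda>t. \<bar>x t\<bar> + t) -` {2}"
    by (auto simp: S_def)
  moreover have "closed ({1..2} \<inter> (\<lambda>t. \<bar>x t\<bar> + t) -` {2})"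
    by (intro continuous_closed_preimage cont') auto
  ultimately have "compact S"
    by (metis Int_lower1 bounded_closed_interval bounded_subset compact_eq_bounded_closed)
  moreover have "S \<noteq> {}"
    using crossing[of 2] by (auto simp: S_def)
  ultimately obtain s where s: "s \<in> S" "\<And>t. t \<in> S \<Longrightarrow> s \<le> t"
    using compact_attains_inf[of S] by blast
  have "\<bar>x r\<bar> < 2 - r" if r: "1 \<le> r" "r < s" for r
  proof (rule ccontr)
    assume "\<not> \<bar>x r\<bar> < 2 - r"
    then obtain r' where "1 \<le> r'" "r' \<le> r" "\<bar>x r'\<bar> + r' = 2"
      using crossing[of r] r by auto
    then have "r' \<in> S"
      using r s(1) by (auto simp: S_def)
    then show False
      using s(2)[of r'] r \<open>r' \<le> r\<close> by simp
  qed
  then show ?thesis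
    using s(1) that[of s] by (auto simp: S_def front_hit_def)
qed

section \<open>Online character of the release times\<close>

lemma postponed_iff:
  "front_hit x s \<Longrightarrow> postponed x y \<longleftrightarrow> s < 2 - \<bar>y\<bar> \<and> 0 < x s * y"
  unfolding postponed_def using front_hit_unique by blast

text \<open>Release times depend on a path only through \<open>s\<close> and \<open>x s\<close>, and
  the movement up to \<open>s\<close> decides that \<open>s\<close> is the front hit.\<close>

lemma release_time_cong:
  assumes "front_hit x s" "\<And>r. r \<in> {0..s} \<Longrightarrow> x r = z r"
  shows "release_time z = release_time x"
proof -
  have "front_hit z s" "x s = z s"
    using assms front_hit_cong[of s x z] by (auto simp: front_hit_def)
  then show ?thesis
    using assms(1) by (auto simp: release_time_def postponed_iff fun_eq_iff)
qed

lemma adaptive_release_time: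
  assumes "\<And>y. y \<in> set qs \<Longrightarrow> \<bar>y\<bar> \<le> 1"
  shows "adaptive_adversary (length qs) (\<lambda>x. map (release_time x) qs)"
  unfolding adaptive_adversary_def
proof (intro conjI allI impI)
  fix x z :: "real \<Rightarrow> real" and t i
  assume *: "agent_path x \<and> agent_path z \<and> (\<forall>s\<in>{0..t}. x s = z s)"
    and i: "i < length qs" and rel: "map (release_time x) qs ! i \<le> t"
  define y where "y = qs ! i"
  have y: "\<bar>y\<bar> \<le> 1" and rel: "release_time x y \<le> t"
    using assms i rel by (auto simp: y_def)
  obtain s s' where s: "front_hit x s" "front_hit z s'"
    using * front_hit_exists by metis
  have "release_time z y = release_time x y"
  proof (cases "s \<le> t \<or> s' \<le> t")
    case True
    then show ?thesis
    proof
      assume "s \<le> t"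
      then show ?thesis using release_time_cong[OF s(1), of z] * by auto
    next
      assume "s' \<le> t"
      then show ?thesis using release_time_cong[OF s(2), of x] * by auto
    qed
  next
    \<comment> \<open>Here \<open>t\<close> precedes both hits, hence \<open>t < 2\<close>, so a
      release by \<open>t\<close> is not a postponed one (at least 3). If it is
      \<open>2 - \<bar>y\<bar>\<close>, it precedes both hits and is postponed on neither
      path.\<close>
    case False
    then show ?thesis
      using rel y front_hit_le[OF s(1)] s
      by (auto simp: release_time_def postponed_iff split: if_splits)
  qed
  then show "map (release_time z) qs ! i = map (release_time x) qs ! i"
    using i by (simp add: y_def)
qed auto

text \<open>The trajectory on the instance without postponements agrees with the one on the instance
  of the adversary up to the front hit, so it produces the same release times.\<close>

lemma consistent_instance:
  assumes A: "online_algorithm A" and qs: "0 \<in> set qs" "\<And>y. y \<in> set qs \<Longrightarrow> \<bar>y\<bar> \<le> 1"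
  obtains Q where "tsp_instance Q" "map location Q = qs"
    "Q = map (\<lambda>y. (y, release_time (trajectory A qs Q) y)) qs"
proof -
  define Q0 where "Q0 = map (\<lambda>y. (y, if y = 0 then 0 else 2 - \<bar>y\<bar>)) qs"
  define x where "x = trajectory A qs Q0"
  define Q where "Q = map (\<lambda>y. (y, release_time x y)) qs"
  have "(0, 0) \<in> set Q0"
    using qs(1) by (force simp: Q0_def)
  then have "tsp_instance Q0"
    using qs(2) by (auto simp: tsp_instance_def Q0_def dest!: qs(2))
  then have "agent_path x"
    using A by (auto simp: online_algorithm_def x_def Q0_def)
  then obtain s where s: "front_hit x s"
    using front_hit_exists by blast
  \<comment> \<open>The two instances differ only in postponed requests, whose release times in both
    instances exceed \<open>s\<close>.\<close>
  have "revealed Q r = revealed Q0 r" if "r \<in> {0..s}" for r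
    using that by (auto simp: revealed_def Q_def Q0_def release_time_def postponed_iff[OF s])
  then have "x r = trajectory A qs Q r" if "r \<in> {0..s}" for r
    using that by (simp add: trajectory_def x_def)
  then have *: "release_time (trajectory A qs Q) = release_time x"
    using release_time_cong[OF s] by blast
  have "(0, 0) \<in> set Q"
    using qs(1) by (force simp: Q_def release_time_def)
  moreover have "0 \<le> release q" if "q \<in> set Q" for q
    using qs(2) that by (auto simp: Q_def release_time_def dest!: qs(2))
  ultimately have "tsp_instance Q"
    by (simp add: tsp_instance_def)
  then show ?thesis
    using that[of Q] unfolding * by (simp add: Q_def comp_def)
qed

section \<open>An offline tour: one end at time 1, the other at time 3, home at time 4\<close>

definition sweep :: "real \<Rightarrow> real" where
  "sweep t = max (min t (2 - t)) (min 0 (t - 4))"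

lemma abs_max_diff_le:
  fixes a b c d e :: real
  shows "\<bar>a - c\<bar> \<le> e \<Longrightarrow> \<bar>b - d\<bar> \<le> e \<Longrightarrow> \<bar>max a b - max c d\<bar> \<le> e"
  by linarith

lemma abs_min_diff_le:
  fixes a b c d e :: real
  shows "\<bar>a - c\<bar> \<le> e \<Longrightarrow> \<bar>b - d\<bar> \<le> e \<Longrightarrow> \<bar>min a b - min c d\<bar> \<le> e"
  by linarith

lemma agent_path_sweep:
  assumes "\<bar>\<sigma>\<bar> = 1"
  shows "agent_path (\<lambda>t. \<sigma> * sweep t)"
proof -
  have "\<bar>\<sigma> * sweep a - \<sigma> * sweep b\<bar> \<le> \<bar>a - b\<bar>" for a b
  proof -
    have "\<bar>\<sigma> * sweep a - \<sigma> * sweep b\<bar> = \<bar>sweep a - sweep b\<bar>"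
      using assms by (metis abs_mult mult_1 right_diff_distrib)
    \<comment> \<open>Each affine piece has slope -1, 0 or 1, and \<open>min\<close> and
      \<open>max\<close> preserve the Lipschitz bound.\<close>
    also have "\<dots> \<le> \<bar>a - b\<bar>"
      unfolding sweep_def by (intro abs_max_diff_le abs_min_diff_le) auto
    finally show ?thesis .
  qed
  then show ?thesis
    by (auto simp: agent_path_def sweep_def intro!: lipschitz_onI simp: dist_real_def)
qed

lemma opt_le_4:
  assumes s: "front_hit x s" and qs: "\<And>y. y \<in> set qs \<Longrightarrow> \<bar>y\<bar> \<le> 1"
  shows "opt (map (\<lambda>y. (y, release_time x y)) qs) \<le> 4"
proof -
  \<comment> \<open>The sign sends the tour first to the side where nothing is postponed. It passes
    \<open>y\<close> there at \<open>2 - \<bar>y\<bar>\<close>, on the way back from the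
    end.\<close>
  define \<sigma> :: real where "\<sigma> = (if 0 < x s then -1 else 1)"
  define w where "w = (\<lambda>t. \<sigma> * sweep t)"
  have "agent_path w"
    unfolding w_def by (rule agent_path_sweep) (simp add: \<sigma>_def)
  have "served w (y, release_time x y) 4" if "y \<in> set qs" for y
  proof (cases "0 \<le> \<sigma> * y")
    case True
    then have "\<not> 0 < x s * y"
      by (auto simp: \<sigma>_def zero_less_mult_iff split: if_splits)
    then have "release_time x y \<le> 2 - \<bar>y\<bar>"
      using qs[OF that] by (simp add: release_time_def postponed_iff[OF s])
    moreover have "w (2 - \<bar>y\<bar>) = y"
      using True qs[OF that] by (auto simp: w_def sweep_def \<sigma>_def min_def max_def split: if_splits)
    ultimately show ?thesis
      unfolding served_def by (intro exI[of _ "2 - \<bar>y\<bar>"]) auto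
  next
    case False
    have "release_time x y \<le> 4 - \<bar>y\<bar>"
      using qs[OF that] by (simp add: release_time_def)
    moreover have "w (4 - \<bar>y\<bar>) = y"
      using False qs[OF that] by (auto simp: w_def sweep_def \<sigma>_def min_def max_def split: if_splits)
    ultimately show ?thesis
      unfolding served_def by (intro exI[of _ "4 - \<bar>y\<bar>"]) auto
  qed
  moreover have "w 4 = 0"
    by (simp add: w_def sweep_def)
  ultimately have "makespan w (map (\<lambda>y. (y, release_time x y)) qs) \<le> ereal 4"
    unfolding makespan_def by (intro INF_lower) auto
  with \<open>agent_path w\<close> show ?thesis
    unfolding opt_def by (intro INF_lower2[of w]) auto
qed

section \<open>Lower bound on the agent's return\<close>

text \<open>Normalised to a hit on the right; \<open>d\<close> stands for the mesh width. If
  \<open>2 - s \<le> d\<close>, there may be no positive grid point below \<open>2 - s\<close>, but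
  then the order right end, left end already costs enough.\<close>

lemma late_return:
  assumes x: "agent_path x" and s: "front_hit x s" "x s = 2 - s"
    and ends: "served x (1, 1) t" "served x (- 1, 1) t"
    and near: "2 - s \<le> d \<or> (\<exists>g. 2 - s - d \<le> g \<and> 0 < g \<and> g < 2 - s \<and> served x (g, 4 - g) t)"
    and t: "0 \<le> t" "x t = 0" and d: "0 \<le> d"
  shows "6 - 2 * d \<le> t"
proof -
  obtain u where u: "1 \<le> u" "u \<le> t" "x u = 1"
    using ends by (auto simp: served_def)
  obtain v where v: "1 \<le> v" "v \<le> t" "x v = - 1"
    using ends by (auto simp: served_def)
  have s1: "1 \<le> s" using s by (simp add: front_hit_def)
  \<comment> \<open>From time 1 on the front lies within distance 1 of the origin, so neither end is
    served before the hit.\<close>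
  have before: "\<bar>x r\<bar> < 1" if "1 \<le> r" "r < s" for r
  proof -
    have "\<bar>x r\<bar> < 2 - r" using s that by (simp add: front_hit_def)
    then show ?thesis using that by linarith
  qed
  have "s \<le> u" using before[of u] u by force
  have "s \<le> v" using before[of v] v by force
  have dist: "\<bar>x a - x b\<bar> \<le> \<bar>a - b\<bar>" if "0 \<le> a" "0 \<le> b" for a b
    using agent_path_dist[OF x] that by blast
  \<comment> \<open>The meeting point \<open>2 - s\<close> has distance \<open>s - 1\<close> to the
    right end and \<open>3 - s\<close> to the left end.\<close>
  have su: "3 - 2 * (2 - s) \<le> u" using dist[of s u] u s s1 \<open>s \<le> u\<close> by simp
  have sv: "3 \<le> v" using dist[of s v] v s s1 \<open>s \<le> v\<close> by simp
  have uv: "2 \<le> \<bar>u - v\<bar>" using dist[of u v] u v by simp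
  have ut: "u + 1 \<le> t" using dist[of u t] u t by simp
  have vt: "v + 1 \<le> t" using dist[of v t] v t by simp
  consider "v \<le> u" | "u < v" "2 - s \<le> d" | "u < v" "\<not> 2 - s \<le> d"
    by linarith
  then show ?thesis
  proof cases
    case 1
    then show ?thesis using sv uv ut d by linarith
  next
    case 2
    then have "u + 2 \<le> v" using uv by simp
    then show ?thesis using su vt 2 by simp
  next
    case 3
    then obtain g where g: "2 - s - d \<le> g" "0 < g" "g < 2 - s" "served x (g, 4 - g) t"
      using near by blast
    then obtain w where w: "4 - g \<le> w" "w \<le> t" "x w = g"
      by (auto simp: served_def)
    have "u + 2 \<le> v" using 3 uv by simp
    \<comment> \<open>If \<open>w\<close> follows \<open>v\<close>, the return is no earlier than
      \<open>6 - 2 * (2 - s) + 2 * g\<close>, hence than \<open>6 - 2 * d\<close>. If it precedes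
      \<open>v\<close>, the release at \<open>4 - g\<close> forces \<open>v \<ge> 5\<close>.\<close>
    moreover have "v + (1 + g) \<le> w \<or> w + (1 + g) \<le> v"
      using dist[of v w] v w g s1 by (simp add: abs_if split: if_splits)
    moreover have "w + g \<le> t" using dist[of w t] w t g s1 by simp
    ultimately show ?thesis using su vt w(1) g(1) d by (elim disjE) simp_all
  qed
qed

lemma served_uminus: "served x (y, r) t \<Longrightarrow> served (\<lambda>t. - x t) (- y, r) t"
  by (fastforce simp: served_def)

section \<open>The grid and the agent's makespan\<close>

lemma grid_bounded: "y \<in> set (grid N) \<Longrightarrow> \<bar>y\<bar> \<le> 1"
  by (auto simp: grid_def abs_if divide_simps split: if_splits)

lemma grid_uminus: "y \<in> set (grid N) \<Longrightarrow> - y \<in> set (grid N)"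
  by (auto simp: grid_def image_iff intro!: bexI[of _ "- _"])

lemma grid_ends: "0 < N \<Longrightarrow> 1 \<in> set (grid N)"
  by (auto simp: grid_def image_iff intro!: bexI[of _ "int N"])

lemma grid_zero: "0 \<in> set (grid N)"
  by (auto simp: grid_def image_iff intro!: bexI[of _ 0])

lemma grid_below:
  assumes "0 < N" "1 / real N < c" "c \<le> 1"
  shows "\<exists>g\<in>set (grid N). c - 1 / real N \<le> g \<and> 0 < g \<and> g < c"
proof -
  \<comment> \<open>The largest integer strictly below \<open>c * real N\<close>. Strictness
    matters: a request exactly at the meeting point is not postponed.\<close>
  define k where "k = \<lceil>c * real N\<rceil> - 1"
  have k: "real_of_int k < c * real N" "c * real N - 1 \<le> real_of_int k"
    unfolding k_def by linarith+
  have "1 < c * real N" "c * real N \<le> real N"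
    using assms by (auto simp: field_simps)
  then have "0 < real_of_int k" "real_of_int k \<le> real_of_int (int N)"
    using k by linarith+
  then have "real_of_int k / real N \<in> set (grid N)"
    by (auto simp: grid_def)
  moreover have "c - 1 / real N \<le> real_of_int k / real N" "0 < real_of_int k / real N"
    "real_of_int k / real N < c"
    using divide_right_mono[OF k(2), of "real N"] k(1) assms(1) \<open>0 < real_of_int k\<close>
    by (auto simp: diff_divide_distrib pos_divide_less_eq)
  ultimately show ?thesis by blast
qed

lemma makespan_ge:
  assumes x: "agent_path x" and N: "0 < N"
  shows "ereal (6 - 2 / real N) \<le> makespan x (map (\<lambda>y. (y, release_time x y)) (grid N))"
  unfolding makespan_def
proof (rule INF_greatest, clarsimp)
  fix t
  assume t: "0 \<le> t" "x t = 0" and srv: "\<forall>y\<in>set (grid N). served x (y, release_time x y) t"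
  obtain s where s: "front_hit x s"
    using front_hit_exists[OF x] by blast
  have s1: "1 \<le> s" and abs_s: "\<bar>x s\<bar> = 2 - s"
    using s by (auto simp: front_hit_def)
  \<comment> \<open>The ends are never postponed, since \<open>s < 2 - 1\<close> contradicts
    \<open>1 \<le> s\<close>.\<close>
  have ends: "served x (1, 1) t" "served x (- 1, 1) t"
    using srv grid_ends[OF N] grid_uminus[OF grid_ends[OF N]] s1
    by (force simp: release_time_def postponed_iff[OF s])+
  \<comment> \<open>Reflection reduces a hit on the left to one on the right.\<close>
  define \<sigma> :: real where "\<sigma> = (if 0 \<le> x s then 1 else - 1)"
  define X where "X = (\<lambda>t. \<sigma> * x t)"
  have \<sigma>: "\<sigma> = 1 \<or> \<sigma> = - 1" by (simp add: \<sigma>_def)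
  have servedX: "served X (\<sigma> * y, r) t" if "served x (y, r) t" for y r
    using \<sigma> that served_uminus[of x y r t] by (auto simp: X_def)
  have "6 - 2 * (1 / real N) \<le> t"
  proof (rule late_return[of X s])
    show "agent_path X"
      using x \<sigma> lipschitz_on_minus[of 1 "{0..}" x] by (auto simp: X_def agent_path_def)
    show "front_hit X s"
      using s \<sigma> by (auto simp: X_def front_hit_def)
    show "X s = 2 - s"
      using abs_s by (auto simp: X_def \<sigma>_def)
    show "served X (1, 1) t" "served X (- 1, 1) t"
      using servedX[OF ends(1)] servedX[OF ends(2)] \<sigma> by auto
    show "2 - s \<le> 1 / real N \<or>
      (\<exists>g. 2 - s - 1 / real N \<le> g \<and> 0 < g \<and> g < 2 - s \<and> served X (g, 4 - g) t)"
    proof (cases "2 - s \<le> 1 / real N")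
      case False
      then obtain g where g: "g \<in> set (grid N)" "2 - s - 1 / real N \<le> g" "0 < g" "g < 2 - s"
        using grid_below[OF N, of "2 - s"] s1 by auto
      have "\<sigma> * g \<in> set (grid N)"
        using \<sigma> g(1) grid_uminus by auto
      moreover have "release_time x (\<sigma> * g) = 4 - g"
        using g abs_s by (auto simp: release_time_def postponed_iff[OF s] \<sigma>_def zero_less_mult_iff)
      ultimately have "served x (\<sigma> * g, 4 - g) t"
        using srv by metis
      then have "served X (g, 4 - g) t"
        using servedX[of "\<sigma> * g" "4 - g"] \<sigma> by auto
      with g show ?thesis by blast
    qed simp
  qed (use t in \<open>auto simp: X_def\<close>)
  then show "6 - 2 / real N \<le> t" by simp
qed

section \<open>Perfect predictions and the ratio 1.5\<close>

lemma prediction_error_exact: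
  assumes "Q \<noteq> []"
  shows "prediction_error Q (map location Q) = 0"
proof -
  have "(\<lambda>i. \<bar>location (Q ! i) - map location Q ! i\<bar>) ` {..<length Q} = {0}"
    using assms by (auto simp: image_iff)
  then show ?thesis
    by (simp add: prediction_error_def Let_def)
qed

lemma opt_nonneg: "0 \<le> opt Q"
  unfolding opt_def makespan_def by (auto intro!: INF_greatest)

theorem theorem2:
  fixes \<epsilon> :: real
  assumes "\<epsilon> > 0"
  shows "(\<nexists>A. online_algorithm A \<and> competitive_within 0 (1.5 - \<epsilon>) A) \<and>
    (\<exists>qs adv. adaptive_adversary (length qs) adv \<and>
      (\<forall>A. online_algorithm A \<longrightarrow>
        (\<exists>Q. tsp_instance Q \<and>
          map location Q = qs \<and>
          map release Q = adv (trajectory A qs Q) \<and>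
          prediction_error Q qs = 0 \<and>
          makespan (trajectory A qs Q) Q > ereal (1.5 - \<epsilon>) * opt Q)))"
proof -
  \<comment> \<open>The bound by \<open>\<epsilon>\<close> gives
    \<open>4 * (1.5 - \<epsilon>) < 6 - 2 / real N\<close>; the bound by 1 keeps the right side
    positive for large \<open>\<epsilon>\<close>.\<close>
  obtain N where N: "0 < N" "1 / real N < min \<epsilon> 1"
    using ex_inverse_of_nat_less[of "min \<epsilon> 1"] assms by (auto simp: inverse_eq_divide)
  define qs where "qs = grid N"
  define adv where "adv = (\<lambda>x. map (release_time x) qs)"
  have qs: "0 \<in> set qs" "\<And>y. y \<in> set qs \<Longrightarrow> \<bar>y\<bar> \<le> 1"
    unfolding qs_def using grid_zero grid_bounded by auto
  have adaptive: "adaptive_adversary (length qs) adv"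
    unfolding adv_def using qs(2) by (rule adaptive_release_time)
  have hard: "\<exists>Q. tsp_instance Q \<and> map location Q = qs \<and> map release Q = adv (trajectory A qs Q) \<and>
      prediction_error Q qs = 0 \<and> makespan (trajectory A qs Q) Q > ereal (1.5 - \<epsilon>) * opt Q"
    if A: "online_algorithm A" for A
  proof -
    obtain Q where Q: "tsp_instance Q" "map location Q = qs"
      "Q = map (\<lambda>y. (y, release_time (trajectory A qs Q) y)) qs"
      using consistent_instance[OF A qs] by blast
    define x where "x = trajectory A qs Q"
    have Qx: "Q = map (\<lambda>y. (y, release_time x y)) qs"
      using Q(3) by (simp add: x_def)
    have x: "agent_path x"
      using A Q(1,2) unfolding online_algorithm_def x_def by force
    then obtain s where "front_hit x s"
      using front_hit_exists by blast
    then have opt: "opt Q \<le> 4"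
      unfolding Qx by (rule opt_le_4) (rule qs(2))
    \<comment> \<open>For \<open>\<epsilon> > 1.5\<close> the factor is negative and could not be
      multiplied onto \<open>opt Q \<le> 4\<close>; truncation at 0 avoids this.\<close>
    define C where "C = max 0 (1.5 - \<epsilon>)"
    have "2 / real N < 2 * \<epsilon>" "2 / real N < 2"
      using mult_strict_left_mono[OF N(2), of 2] by auto
    then have C: "0 \<le> C" "1.5 - \<epsilon> \<le> C" "C * 4 < 6 - 2 / real N"
      using assms by (auto simp: C_def max_def)
    have "ereal (1.5 - \<epsilon>) * opt Q \<le> ereal C * opt Q"
      using C(2) opt_nonneg by (intro ereal_mult_right_mono) auto
    also have "\<dots> \<le> ereal C * 4"
      using C(1) opt by (intro ereal_mult_left_mono) auto
    also have "\<dots> < ereal (6 - 2 / real N)"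
      using C(3) by simp
    also have "\<dots> \<le> makespan x Q"
      unfolding Qx qs_def by (rule makespan_ge[OF x N(1)])
    finally have "makespan x Q > ereal (1.5 - \<epsilon>) * opt Q" .
    moreover have "map release Q = adv x"
      by (simp add: Qx adv_def)
    moreover have "prediction_error Q qs = 0"
      using prediction_error_exact[of Q] Q(1,2) by (cases "Q = []") (auto simp: tsp_instance_def)
    ultimately show ?thesis
      using Q(1,2) unfolding x_def by blast
  qed
  have "\<not> competitive_within 0 (1.5 - \<epsilon>) A" if A: "online_algorithm A" for A
  proof
    assume comp: "competitive_within 0 (1.5 - \<epsilon>) A"
    obtain Q where Q: "tsp_instance Q" "map location Q = qs" "prediction_error Q qs = 0"
      "makespan (trajectory A qs Q) Q > ereal (1.5 - \<epsilon>) * opt Q"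
      using hard[OF A] by blast
    have "length qs = length Q"
      using Q(2) by auto
    with comp Q(1,3) have "makespan (trajectory A qs Q) Q \<le> ereal (1.5 - \<epsilon>) * opt Q"
      unfolding competitive_within_def by simp
    with Q(4) show False by simp
  qed
  with adaptive hard show ?thesis by blast
qed

end
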